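(* If $\mathbf X=(X,\lambda_X)$ is a ditopological left unosemigroup, then its Hartman-Mycielski extension $HM(\mathbf X)=(HM(X),\lambda_{HM(X)})$ is a ditopological left unosemigroup.
   Context: A topological semigroup is a non-empty topological space $S$ endowed with a continuous associative binary operation $\cdot:S\times S\to S$. A left unit operation on $S$ is a map $\lambda:S\to S$ with $\lambda(x)\cdot x=x$ for all $x\in S$. For $A,B\subset S$ put $A\leftthreetimes B=\{x\in S: ax\in B \text{ for some } a\in A\}$. A continuous left unit operation $\lambda$ is dicontinuous if for every $x\in S$ and every neighborhood $O_x\subset S$ of $x$ there are a neighborhood $U_x\subset S$ of $x$ and a neighborhood $W_{\lambda(x)}\subset\lambda(S)$ of $\lambda(x)$ in the subspace $\lambda(S)$ such that $(W_{\lambda(x)}\leftthreetimes U_x)\cap\lambda^{-1}(W_{\lambda(x)})\subset O_x$. A ditopological left unosemigroup $(S,\lambda)$ is a topological semigroup $S$ endowed with a dicontinuous left unit operation $\lambda$. Hartman-Mycielski extension: for a topological space $X$, $HM(X)$ is the set of all functions $f:[0,1)\to X$ for which there are $n\in\mathbb N$ and $0=a_0<a_1<\dots<a_n=1$ such that $f$ is constant on each $[a_i,a_{i+1})$, $0\le i<n$. A neighborhood sub-base at $f\in HM(X)$ consists of the sets $N(a,b,V,\varepsilon)=\{g\in HM(X): |\{t\in[a,b): g(t)\notin V\}|<\varepsilon\}$, where $0\le a<b\le 1$, $f$ is constant on $[a,b)$, $V$ is a neighborhood of $f(a)$ in $X$, $\varepsilon>0$, and $|\cdot|$ is Lebesgue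 measure. If $X$ is a topological semigroup, $HM(X)$ is a topological semigroup under pointwise multiplication, and for a continuous left unit operation $\lambda_X$ on $X$, $\lambda_{HM(X)}(f)=\lambda_X\circ f$ is a continuous left unit operation on $HM(X)$. *)

theory Defs
  imports "HOL-Analysis.Analysis"
begin

text \<open>
  Spaces are carrier-based (\<^typ>\<open>'a topology\<close>), because the Hartman-Mycielski extension lives
  on a proper subset of a function type; operations only matter on the carrier.
\<close>

text \<open>Neighbourhoods are not required to be open.\<close>

definition nbhd :: "'a topology \<Rightarrow> 'a \<Rightarrow> 'a set \<Rightarrow> bool" where
  "nbhd X x V \<longleftrightarrow> V \<subseteq> topspace X \<and> (\<exists>U. openin X U \<and> x \<in> U \<and> U \<subseteq> V)"

definition topological_semigroup :: "'a topology \<Rightarrow> ('a \<Rightarrow> 'a \<Rightarrow> 'a) \<Rightarrow> bool" where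
  "topological_semigroup X m \<longleftrightarrow>
     topspace X \<noteq> {} \<and>
     continuous_map (prod_topology X X) X (\<lambda>(x, y). m x y) \<and>
     (\<forall>x\<in>topspace X. \<forall>y\<in>topspace X. \<forall>z\<in>topspace X. m (m x y) z = m x (m y z))"

definition left_unit_operation ::
    "'a topology \<Rightarrow> ('a \<Rightarrow> 'a \<Rightarrow> 'a) \<Rightarrow> ('a \<Rightarrow> 'a) \<Rightarrow> bool" where
  "left_unit_operation X m l \<longleftrightarrow>
     l \<in> topspace X \<rightarrow> topspace X \<and> (\<forall>x\<in>topspace X. m (l x) x = x)"

definition left_quot ::
    "'a topology \<Rightarrow> ('a \<Rightarrow> 'a \<Rightarrow> 'a) \<Rightarrow> 'a set \<Rightarrow> 'a set \<Rightarrow> 'a set" where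
  "left_quot X m A B = {x \<in> topspace X. \<exists>a\<in>A. m a x \<in> B}"

definition dicontinuous ::
    "'a topology \<Rightarrow> ('a \<Rightarrow> 'a \<Rightarrow> 'a) \<Rightarrow> ('a \<Rightarrow> 'a) \<Rightarrow> bool" where
  "dicontinuous X m l \<longleftrightarrow>
     continuous_map X X l \<and>
     (\<forall>x\<in>topspace X. \<forall>Ox. nbhd X x Ox \<longrightarrow>
        (\<exists>U W. nbhd X x U \<and>
               nbhd (subtopology X (l ` topspace X)) (l x) W \<and>
               left_quot X m W U \<inter> {y \<in> topspace X. l y \<in> W} \<subseteq> Ox))"

definition ditopological_left_unosemigroup ::
    "'a topology \<Rightarrow> ('a \<Rightarrow> 'a \<Rightarrow> 'a) \<Rightarrow> ('a \<Rightarrow> 'a) \<Rightarrow> bool" where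
  "ditopological_left_unosemigroup X m l \<longleftrightarrow>
     topological_semigroup X m \<and> left_unit_operation X m l \<and> dicontinuous X m l"

text \<open>
  Functions on \<open>[0,1)\<close> are represented by functions on \<^typ>\<open>real\<close> that take the value
  \<^term>\<open>undefined\<close> outside \<open>[0,1)\<close>.
\<close>

definition HM :: "'a topology \<Rightarrow> (real \<Rightarrow> 'a) set" where
  "HM X = {f \<in> {0..<1} \<rightarrow>\<^sub>E topspace X.
     \<exists>(n::nat) (a::nat \<Rightarrow> real). a 0 = 0 \<and> a n = 1 \<and> (\<forall>i<n. a i < a (Suc i)) \<and>
       (\<forall>i<n. \<forall>t\<in>{a i..<a (Suc i)}. f t = f (a i))}"

definition HM_N :: "'a topology \<Rightarrow> real \<Rightarrow> real \<Rightarrow> 'a set \<Rightarrow> real \<Rightarrow> (real \<Rightarrow> 'a) set" where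
  "HM_N X a b V e = {g \<in> HM X. measure lebesgue {t \<in> {a..<b}. g t \<notin> V} < e}"

definition HM_subbase_at :: "'a topology \<Rightarrow> (real \<Rightarrow> 'a) \<Rightarrow> (real \<Rightarrow> 'a) set set" where
  "HM_subbase_at X f =
     {HM_N X a b V e | a b V e. 0 \<le> a \<and> a < b \<and> b \<le> 1 \<and> (\<forall>t\<in>{a..<b}. f t = f a) \<and>
        nbhd X (f a) V \<and> 0 < e}"

text \<open>
  The topology determined by the neighbourhood sub-bases: a set is open iff with each of its points
  \<open>f\<close> it contains a finite intersection of members of the sub-base at \<open>f\<close>. The empty
  intersection is the whole of \<^term>\<open>HM X\<close>.
\<close>

definition HM_topology :: "'a topology \<Rightarrow> (real \<Rightarrow> 'a) topology" where
  "HM_topology X = topology (\<lambda>U. U \<subseteq> HM X \<and>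
     (\<forall>f\<in>U. \<exists>\<F>. finite \<F> \<and> \<F> \<subseteq> HM_subbase_at X f \<and> HM X \<inter> \<Inter>\<F> \<subseteq> U))"

definition HM_mult :: "('a \<Rightarrow> 'a \<Rightarrow> 'a) \<Rightarrow> (real \<Rightarrow> 'a) \<Rightarrow> (real \<Rightarrow> 'a) \<Rightarrow> real \<Rightarrow> 'a" where
  "HM_mult m f g = (\<lambda>t\<in>{0..<1}. m (f t) (g t))"

definition HM_unit :: "('a \<Rightarrow> 'a) \<Rightarrow> (real \<Rightarrow> 'a) \<Rightarrow> real \<Rightarrow> 'a" where
  "HM_unit l f = (\<lambda>t\<in>{0..<1}. l (f t))"

lemma istopology_HM:
  "istopology (\<lambda>U. U \<subseteq> HM X \<and>
     (\<forall>f\<in>U. \<exists>\<F>. finite \<F> \<and> \<F> \<subseteq> HM_subbase_at X f \<and> HM X \<inter> \<Inter>\<F> \<subseteq> U))"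
  unfolding istopology_def
proof (rule conjI; intro allI impI conjI ballI)
  fix S T f
  assume S: "S \<subseteq> HM X \<and>
     (\<forall>f\<in>S. \<exists>\<F>. finite \<F> \<and> \<F> \<subseteq> HM_subbase_at X f \<and> HM X \<inter> \<Inter>\<F> \<subseteq> S)"
    and T: "T \<subseteq> HM X \<and>
     (\<forall>f\<in>T. \<exists>\<F>. finite \<F> \<and> \<F> \<subseteq> HM_subbase_at X f \<and> HM X \<inter> \<Inter>\<F> \<subseteq> T)"
    and f: "f \<in> S \<inter> T"
  from S f obtain \<F> where F: "finite \<F>" "\<F> \<subseteq> HM_subbase_at X f" "HM X \<inter> \<Inter>\<F> \<subseteq> S"
    by (meson IntD1)
  from T f obtain \<G> where G: "finite \<G>" "\<G> \<subseteq> HM_subbase_at X f" "HM X \<inter> \<Inter>\<G> \<subseteq> T"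
    by (meson IntD2)
  show "\<exists>\<F>. finite \<F> \<and> \<F> \<subseteq> HM_subbase_at X f \<and> HM X \<inter> \<Inter>\<F> \<subseteq> S \<inter> T"
  proof (intro exI conjI)
    show "finite (\<F> \<union> \<G>)" using F(1) G(1) by simp
    show "\<F> \<union> \<G> \<subseteq> HM_subbase_at X f" using F(2) G(2) by simp
    show "HM X \<inter> \<Inter>(\<F> \<union> \<G>) \<subseteq> S \<inter> T"
      using F(3) G(3) by (simp add: Inter_Un_distrib) blast
  qed
next
  fix S T :: "(real \<Rightarrow> 'a) set"
  assume "S \<subseteq> HM X \<and>
     (\<forall>f\<in>S. \<exists>\<F>. finite \<F> \<and> \<F> \<subseteq> HM_subbase_at X f \<and> HM X \<inter> \<Inter>\<F> \<subseteq> S)"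
  then show "S \<inter> T \<subseteq> HM X" by (meson inf.coboundedI1)
next
  fix \<K>
  assume K: "\<forall>K\<in>\<K>. K \<subseteq> HM X \<and>
     (\<forall>f\<in>K. \<exists>\<F>. finite \<F> \<and> \<F> \<subseteq> HM_subbase_at X f \<and> HM X \<inter> \<Inter>\<F> \<subseteq> K)"
  then show "\<Union>\<K> \<subseteq> HM X" by (meson Sup_least)
  fix f assume "f \<in> \<Union>\<K>"
  then obtain K where k: "K \<in> \<K>" "f \<in> K" by (rule UnionE)
  with K obtain \<F> where F: "finite \<F>" "\<F> \<subseteq> HM_subbase_at X f" "HM X \<inter> \<Inter>\<F> \<subseteq> K"
    by meson
  have "K \<subseteq> \<Union>\<K>" using k(1) by (rule Union_upper)
  with F show "\<exists>\<F>. finite \<F> \<and> \<F> \<subseteq> HM_subbase_at X f \<and> HM X \<inter> \<Inter>\<F> \<subseteq> \<Union>\<K>"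
    by (meson subset_trans)
qed

lemma openin_HM_topology:
  "openin (HM_topology X) U \<longleftrightarrow> U \<subseteq> HM X \<and>
     (\<forall>f\<in>U. \<exists>\<F>. finite \<F> \<and> \<F> \<subseteq> HM_subbase_at X f \<and> HM X \<inter> \<Inter>\<F> \<subseteq> U)"
  unfolding HM_topology_def topology_inverse'[OF istopology_HM] by (rule refl)

lemma topspace_HM_topology: "topspace (HM_topology X) = HM X"
proof (rule subset_antisym)
  show "topspace (HM_topology X) \<subseteq> HM X"
    using openin_topspace[of "HM_topology X"] unfolding openin_HM_topology by (rule conjunct1)
  have "openin (HM_topology X) (HM X)"
    unfolding openin_HM_topology
  proof (intro conjI ballI exI)
    show "finite {}" "{} \<subseteq> HM_subbase_at X f" "HM X \<inter> \<Inter>{} \<subseteq> HM X" for f by simp_all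
  qed simp
  then show "HM X \<subseteq> topspace (HM_topology X)" by (rule openin_subset)
qed

end

theory Submission
  imports Defs
begin

text \<open>
  For a step function \<open>V\<close> on \<open>[0,1)\<close> whose values are open sets of \<open>X\<close>, let \<open>HM_ball X V e\<close> be
  the set of all \<open>g\<close> in \<open>HM X\<close> with \<open>g t \<in> V t\<close> outside a set of measure less than \<open>e\<close>. These sets
  are open, and those with \<open>f t \<in> V t\<close> for all \<open>t\<close> form a neighbourhood base at \<open>f\<close>. Neighbourhoods
  witnessing continuity or dicontinuity in \<open>X\<close> can be chosen as a function of the finitely many
  values of the step functions involved, so they again form step functions; the
  exceptional sets of the resulting balls add up, which halves or thirds \<open>e\<close>.
\<close>

section \<open>Step functions on the half-open unit interval\<close>

text \<open>This is the step condition of \<open>HM\<close> without the demand that values lie in a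
  given space. It can thus be used for functions valued in pairs, in sets (assignments of
  neighbourhoods) and in \<open>bool\<close>.\<close>

definition step :: "(real \<Rightarrow> 'b) \<Rightarrow> bool" where
  "step f \<longleftrightarrow> (\<exists>(n::nat) (a::nat \<Rightarrow> real). a 0 = 0 \<and> a n = 1 \<and> (\<forall>i<n. a i < a (Suc i)) \<and>
       (\<forall>i<n. \<forall>t\<in>{a i..<a (Suc i)}. f t = f (a i)))"

lemma HM_iff: "f \<in> HM X \<longleftrightarrow> f \<in> {0..<1} \<rightarrow>\<^sub>E topspace X \<and> step f"
  by (simp add: HM_def step_def)

lemma partition_cover:
  fixes a :: "nat \<Rightarrow> real"
  assumes "a 0 \<le> t" "t < a n"
  shows "\<exists>i<n. a i \<le> t \<and> t < a (Suc i)"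
  using assms
proof (induction n)
  case (Suc n)
  then show ?case
    by (cases "t < a n") (auto simp: less_Suc_eq not_less)
qed simp

lemma partition_mono:
  fixes a :: "nat \<Rightarrow> real"
  assumes "\<forall>i<n. a i < a (Suc i)" "i \<le> j" "j \<le> n"
  shows "a i \<le> a j"
  using assms(2,3)
proof (induction j rule: dec_induct)
  case (step k)
  then show ?case using assms(1) by (meson Suc_leD Suc_le_lessD less_eq_real_def order_trans)
qed simp

text \<open>
  A description by an unordered set of breakpoints, for which a common refinement is just a union.
\<close>

lemma step_iff:
  "step f \<longleftrightarrow> (\<exists>S. finite S \<and> (\<forall>s t. 0 \<le> s \<and> s \<le> t \<and> t < 1 \<and> S \<inter> {s<..t} = {} \<longrightarrow> f s = f t))"
proof
  assume "step f"
  then obtain n a where a: "a 0 = 0" "a n = 1" "\<forall>i<n. a i < a (Suc i)"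
    "\<forall>i<n. \<forall>t\<in>{a i..<a (Suc i)}. f t = f (a i)"
    unfolding step_def by blast
  \<comment> \<open>The interval \<open>{s<..t}\<close> is open on the left because the cells
    \<open>{a i..<a (Suc i)}\<close> contain their left ends: \<open>s\<close> may be a breakpoint,
    but none may be met on the way from \<open>s\<close> up to and including
    \<open>t\<close>.\<close>
  have "f s = f t" if st: "0 \<le> s" "s \<le> t" "t < 1" "a ` {..n} \<inter> {s<..t} = {}" for s t
  proof -
    obtain i where i: "i < n" "a i \<le> s" "s < a (Suc i)"
      using partition_cover[of a s n] a(1,2) st by auto
    have "a (Suc i) \<notin> {s<..t}"
      using st(4) i(1) by (auto simp: disjoint_iff)
    then have "t < a (Suc i)" using i by auto
    then have "s \<in> {a i..<a (Suc i)}" "t \<in> {a i..<a (Suc i)}" using i st(2) by auto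
    with a(4) i(1) have "f s = f (a i)" "f t = f (a i)" by blast+
    then show ?thesis by simp
  qed
  then show "\<exists>S. finite S \<and> (\<forall>s t. 0 \<le> s \<and> s \<le> t \<and> t < 1 \<and> S \<inter> {s<..t} = {} \<longrightarrow> f s = f t)"
    by (intro exI[of _ "a ` {..n}"]) auto
next
  assume "\<exists>S. finite S \<and> (\<forall>s t. 0 \<le> s \<and> s \<le> t \<and> t < 1 \<and> S \<inter> {s<..t} = {} \<longrightarrow> f s = f t)"
  then obtain S where fin: "finite S"
    and S: "\<And>s t. 0 \<le> s \<Longrightarrow> s \<le> t \<Longrightarrow> t < 1 \<Longrightarrow> S \<inter> {s<..t} = {} \<Longrightarrow> f s = f t" by blast
  \<comment> \<open>Clipping \<open>S\<close> to the open interval and adding both ends makes the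
    sorted list run from 0 to 1, as a partition must.\<close>
  define T where "T = {0,1} \<union> (S \<inter> {0<..<1})"
  define xs where "xs = sorted_list_of_set T"
  define n where "n = length xs - 1"
  have T: "finite T" "0 \<in> T" "1 \<in> T" "\<And>x. x \<in> T \<Longrightarrow> 0 \<le> x \<and> x \<le> 1"
    using fin by (auto simp: T_def)
  have set: "set xs = T" using T by (simp add: xs_def)
  then have ne: "length xs = Suc n"
    using T(2) by (cases xs) (auto simp: n_def)
  have less: "xs ! i < xs ! j" if "i < j" "j \<le> n" for i j
    using sorted_wrt_nth_less[of "(<)" xs i j] strict_sorted_list_of_set[of T] that ne
    by (simp add: xs_def)
  have inT: "xs ! i \<in> T" if "i \<le> n" for i
    using set ne that by (metis le_imp_less_Suc nth_mem)
  have ex: "\<exists>j\<le>n. xs ! j = x" if "x \<in> T" for x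
    using that set ne by (metis in_set_conv_nth less_Suc_eq_le)
  have mono: "i < j" if "xs ! i < xs ! j" "i \<le> n" for i j
    using less[of j i] that by (cases i j rule: linorder_cases) auto
  have "xs ! 0 = 0"
  proof -
    obtain j where j: "j \<le> n" "xs ! j = 0" using ex[OF T(2)] by blast
    with less[of 0 j] T(4)[OF inT[of 0]] show ?thesis by (cases "j = 0") auto
  qed
  moreover have "xs ! n = 1"
  proof -
    obtain j where j: "j \<le> n" "xs ! j = 1" using ex[OF T(3)] by blast
    with less[of j n] T(4)[OF inT[of n]] show ?thesis by (cases "j = n") auto
  qed
  moreover have "\<forall>i<n. xs ! i < xs ! Suc i"
    using less by simp
  moreover have "f t = f (xs ! i)" if i: "i < n" and t: "t \<in> {xs ! i..<xs ! Suc i}" for i t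
  proof -
    have b: "0 \<le> xs ! i" "xs ! Suc i \<le> 1"
      using T(4) inT[of i] inT[of "Suc i"] i by auto
    \<comment> \<open>A point of this intersection would be an entry of \<open>xs\<close> strictly
      between two consecutive ones, so its index would lie strictly between \<open>i\<close> and
      \<open>Suc i\<close>.\<close>
    have "S \<inter> {xs ! i<..t} = {}"
    proof (rule ccontr)
      assume "S \<inter> {xs ! i<..t} \<noteq> {}"
      then obtain s where s: "s \<in> S" "xs ! i < s" "s \<le> t" by auto
      then have "s \<in> T" using t b by (auto simp: T_def)
      then obtain j where j: "j \<le> n" "xs ! j = s" using ex by blast
      have "xs ! i < xs ! j" "xs ! j < xs ! Suc i" using s t j by auto
      with mono[of i j] mono[of j "Suc i"] i j show False by simp
    qed
    then show ?thesis using S[of "xs ! i" t] b t by auto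
  qed
  ultimately show "step f"
    unfolding step_def by (intro exI[of _ n] exI[of _ "\<lambda>i. xs ! i"]) blast
qed

lemma step_const: "step (\<lambda>t. c)"
  unfolding step_iff by auto

lemma step_ivl: "step (\<lambda>t. t \<in> {a..<b})"
  unfolding step_iff
proof (intro exI[of _ "{a,b}"] conjI allI impI)
  fix s t :: real
  assume "0 \<le> s \<and> s \<le> t \<and> t < 1 \<and> {a, b} \<inter> {s<..t} = {}"
  then show "(s \<in> {a..<b}) = (t \<in> {a..<b})" by auto
qed simp

text \<open>The union of the two breakpoint sets serves both functions. Pairing is the way to bring
  several step functions to a common partition.\<close>

lemma step_Pair:
  assumes "step f" "step g" shows "step (\<lambda>t. (f t, g t))"
proof -
  obtain S T where "finite S" "finite T"
    "\<forall>s t. 0 \<le> s \<and> s \<le> t \<and> t < 1 \<and> S \<inter> {s<..t} = {} \<longrightarrow> f s = f t"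
    "\<forall>s t. 0 \<le> s \<and> s \<le> t \<and> t < 1 \<and> T \<inter> {s<..t} = {} \<longrightarrow> g s = g t"
    using assms unfolding step_iff by blast
  then show ?thesis
    unfolding step_iff by (intro exI[of _ "S \<union> T"]) (simp add: Int_Un_distrib2)
qed

text \<open>Composition keeps the breakpoints, whatever the map \<open>h\<close>. Applied to choice
  functions, it turns neighbourhoods chosen from the values of a step function into a step function
  of neighbourhoods.\<close>

lemma step_map:
  assumes "step f" shows "step (\<lambda>t. h (f t))"
  using assms unfolding step_iff by metis

lemma step_map2:
  assumes "step f" "step g" shows "step (\<lambda>t. h (f t) (g t))"
  using step_map[OF step_Pair[OF assms], of "\<lambda>(x, y). h x y"] by simp

text \<open>The breakpoint criterion looks only at arguments in \<open>{0..<1}\<close>, where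
  restriction changes nothing.\<close>

lemma step_restrict: "step (restrict f {0..<1}) \<longleftrightarrow> step f"
  unfolding step_iff by (intro ex_cong1 conj_cong refl) auto

text \<open>The set is the union of the finitely many cells at whose left ends \<open>P\<close>
  holds. This supplies the measurability that monotonicity and subadditivity of
  \<open>measure\<close> ask for.\<close>

lemma step_Collect_lmeasurable:
  assumes "step P" shows "{t \<in> {0..<1}. P t} \<in> lmeasurable"
proof -
  obtain n a where a: "a 0 = 0" "a n = 1" "\<forall>i<n. a i < a (Suc i)"
    "\<forall>i<n. \<forall>t\<in>{a i..<a (Suc i)}. P t = P (a i)"
    using assms unfolding step_def by blast
  have "{t \<in> {0..<1}. P t} = (\<Union>i\<in>{i. i < n \<and> P (a i)}. {a i..<a (Suc i)})"
  proof (intro set_eqI iffI)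
    fix t assume t: "t \<in> {t \<in> {0..<1}. P t}"
    then obtain i where i: "i < n" "t \<in> {a i..<a (Suc i)}"
      using partition_cover[of a t n] a(1,2) by auto
    with a(4) t have "P (a i)" by blast
    with i show "t \<in> (\<Union>i\<in>{i. i < n \<and> P (a i)}. {a i..<a (Suc i)})" by auto
  next
    fix t assume "t \<in> (\<Union>i\<in>{i. i < n \<and> P (a i)}. {a i..<a (Suc i)})"
    then obtain i where i: "i < n" "P (a i)" "t \<in> {a i..<a (Suc i)}" by auto
    have "0 \<le> a i" "a (Suc i) \<le> 1"
      using partition_mono[OF a(3), of 0 i] partition_mono[OF a(3), of "Suc i" n] a(1,2) i(1) by auto
    moreover have "P t" using a(4) i by blast
    ultimately show "t \<in> {t \<in> {0..<1}. P t}" using i(3) by auto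
  qed
  also have "\<dots> \<in> lmeasurable"
    by (intro fmeasurable.finite_UN) (auto intro: bounded_set_imp_lmeasurable)
  finally show ?thesis .
qed

section \<open>A neighbourhood base of the Hartman-Mycielski extension\<close>

definition HM_ball :: "'a topology \<Rightarrow> (real \<Rightarrow> 'a set) \<Rightarrow> real \<Rightarrow> (real \<Rightarrow> 'a) set" where
  "HM_ball X V e = {g \<in> HM X. measure lebesgue {t \<in> {0..<1}. g t \<notin> V t} < e}"

lemma exceptional_lmeasurable:
  assumes "step g" "step V" shows "{t \<in> {0..<1}. g t \<notin> V t} \<in> lmeasurable"
  by (rule step_Collect_lmeasurable) (rule step_map2[OF assms])

lemma HM_ballI:
  assumes "f \<in> HM X" "0 < e" "\<And>t. t \<in> {0..<1} \<Longrightarrow> f t \<in> V t"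
  shows "f \<in> HM_ball X V e"
proof -
  have "{t \<in> {0..<1}. f t \<notin> V t} = {}" using assms(3) by auto
  then show ?thesis using assms(1,2) unfolding HM_ball_def by (simp only: mem_Collect_eq) simp
qed

lemma exceptional_ivl_lmeasurable:
  assumes "step g" "0 \<le> a" "b \<le> 1"
  shows "{t \<in> {a..<b}. g t \<notin> V} \<in> lmeasurable"
proof -
  have "{t \<in> {a..<b}. g t \<notin> V} = {t \<in> {0..<1}. t \<in> {a..<b} \<and> g t \<notin> V}"
    using assms(2,3) by auto
  also have "\<dots> \<in> lmeasurable"
    by (rule step_Collect_lmeasurable)
      (rule step_map2[OF step_ivl assms(1), of "\<lambda>p x. p \<and> x \<notin> V"])
  finally show ?thesis .
qed

text \<open>A point \<open>g\<close> of the ball leaves a positive slack \<open>e - d\<close>, where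
  \<open>d\<close> is the measure of its exceptional set. If \<open>h\<close> is close enough to
  \<open>g\<close> on the cells where \<open>g\<close> obeys \<open>V\<close>, then its exceptional
  set is covered by that of \<open>g\<close> and a set of measure below the slack.\<close>

lemma openin_HM_ball:
  assumes V: "step V" "\<And>t. t \<in> {0..<1} \<Longrightarrow> openin X (V t)"
  shows "openin (HM_topology X) (HM_ball X V e)"
  unfolding openin_HM_topology
proof (intro conjI ballI)
  show "HM_ball X V e \<subseteq> HM X" by (auto simp: HM_ball_def)
next
  fix g assume "g \<in> HM_ball X V e"
  then have g: "g \<in> HM X" "step g" "measure lebesgue {t \<in> {0..<1}. g t \<notin> V t} < e"
    by (auto simp: HM_ball_def HM_iff)
  define d where "d = measure lebesgue {t \<in> {0..<1}. g t \<notin> V t}"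
  have "step (\<lambda>t. (g t, V t))" by (rule step_Pair[OF g(2) V(1)])
  then obtain n a where a: "a 0 = 0" "a n = 1" "\<forall>i<n. a i < a (Suc i)"
    "\<forall>i<n. \<forall>t\<in>{a i..<a (Suc i)}. (g t, V t) = (g (a i), V (a i))"
    unfolding step_def by blast
  have bd: "0 \<le> a i" "a (Suc i) \<le> 1" "a i < 1" if "i < n" for i
    using partition_mono[OF a(3), of 0 i] partition_mono[OF a(3), of "Suc i" n] a(1-3) that
    by (auto intro: less_le_trans)
  \<comment> \<open>On a cell outside \<open>I\<close>, \<open>g\<close> misses \<open>V\<close>
    throughout, so the cell is already counted in \<open>d\<close>. Only the cells in
    \<open>I\<close> call for a sub-basic neighbourhood.\<close>
  define I where "I = {i. i < n \<and> g (a i) \<in> V (a i)}"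
  \<comment> \<open>At most \<open>n\<close> cells share the slack; dividing by \<open>n + 1\<close>
    keeps their total strictly below it.\<close>
  define r where "r = (e - d) / (n + 1)"
  have r: "0 < r" using g(3) by (simp add: r_def d_def)
  define F where "F = (\<lambda>i. HM_N X (a i) (a (Suc i)) (V (a i)) r) ` I"
  have [simp]: "finite I" by (simp add: I_def)
  have cardI: "card I \<le> n"
    using card_mono[of "{..<n}" I] by (auto simp: I_def)
  have "F \<subseteq> HM_subbase_at X g"
  proof
    fix N assume "N \<in> F"
    then obtain i where i: "i < n" "g (a i) \<in> V (a i)" "N = HM_N X (a i) (a (Suc i)) (V (a i)) r"
      by (auto simp: F_def I_def)
    have "nbhd X (g (a i)) (V (a i))"
      using V(2)[of "a i"] bd[OF i(1)] i(2) openin_subset unfolding nbhd_def by fastforce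
    moreover have "\<forall>t\<in>{a i..<a (Suc i)}. g t = g (a i)" using a(4) i(1) by blast
    ultimately show "N \<in> HM_subbase_at X g"
      using i a(3) bd[OF i(1)] r unfolding HM_subbase_at_def by blast
  qed
  moreover have "HM X \<inter> \<Inter>F \<subseteq> HM_ball X V e"
  proof
    fix h assume h: "h \<in> HM X \<inter> \<Inter>F"
    then have hs: "step h" by (simp add: HM_iff)
    let ?B = "\<lambda>i. {t \<in> {a i..<a (Suc i)}. h t \<notin> V (a i)}"
    have B: "?B i \<in> lmeasurable" if "i \<in> I" for i
      using that bd[of i] by (intro exceptional_ivl_lmeasurable[OF hs]) (auto simp: I_def)
    have small: "measure lebesgue (?B i) \<le> r" if "i \<in> I" for i
      using h that by (auto simp: F_def HM_N_def)
    have "{t \<in> {0..<1}. h t \<notin> V t} \<subseteq> {t \<in> {0..<1}. g t \<notin> V t} \<union> (\<Union>i\<in>I. ?B i)"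
    proof
      fix t assume t: "t \<in> {t \<in> {0..<1}. h t \<notin> V t}"
      then obtain i where i: "i < n" "t \<in> {a i..<a (Suc i)}"
        using partition_cover[of a t n] a(1,2) by auto
      with a(4) have "(g t, V t) = (g (a i), V (a i))" by blast
      then have "g t = g (a i)" "V t = V (a i)" by simp_all
      with i t show "t \<in> {t \<in> {0..<1}. g t \<notin> V t} \<union> (\<Union>i\<in>I. ?B i)"
        by (auto simp: I_def)
    qed
    then have "measure lebesgue {t \<in> {0..<1}. h t \<notin> V t}
        \<le> measure lebesgue ({t \<in> {0..<1}. g t \<notin> V t} \<union> (\<Union>i\<in>I. ?B i))"
      by (intro measure_mono_fmeasurable fmeasurableD exceptional_lmeasurable fmeasurable.Un
          fmeasurable.finite_UN hs g V B) auto
    also have "\<dots> \<le> d + measure lebesgue (\<Union>i\<in>I. ?B i)"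
      unfolding d_def
      by (intro measure_Un_le fmeasurableD exceptional_lmeasurable fmeasurable.finite_UN g V B) auto
    also have "measure lebesgue (\<Union>i\<in>I. ?B i) \<le> (\<Sum>i\<in>I. measure lebesgue (?B i))"
      by (intro measure_UNION_le fmeasurableD B) auto
    also have "\<dots> \<le> card I * r"
      using sum_bounded_above[of I, OF small] by simp
    also have "\<dots> \<le> n * r" using cardI r by simp
    also have "n * r < e - d"
    proof -
      have "(n + 1) * r = e - d" by (simp add: r_def)
      with r show ?thesis by (simp add: algebra_simps)
    qed
    finally show "h \<in> HM_ball X V e" using h by (simp add: HM_ball_def)
  qed
  ultimately show "\<exists>\<F>. finite \<F> \<and> \<F> \<subseteq> HM_subbase_at X g \<and> HM X \<inter> \<Inter>\<F> \<subseteq> HM_ball X V e"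
    by (intro exI[of _ F]) (simp add: F_def)
qed

text \<open>Induction on the family: a new sub-basic set is absorbed by shrinking \<open>V\<close>
  on its interval and lowering the bound on the measure.\<close>

lemma HM_ball_subset_Inter:
  assumes f: "f \<in> HM X" and F: "finite \<F>" "\<F> \<subseteq> HM_subbase_at X f"
  shows "\<exists>V e. step V \<and> 0 < e \<and> (\<forall>t\<in>{0..<1}. openin X (V t) \<and> f t \<in> V t) \<and>
    HM_ball X V e \<subseteq> HM X \<inter> \<Inter>\<F>"
  using F
proof (induction \<F> rule: finite_induct)
  \<comment> \<open>The empty intersection is all of \<open>HM X\<close>. The constant assignment
    \<open>topspace X\<close> with any positive bound, here 1, will do.\<close>
  case empty
  show ?case
    using f by (intro exI[of _ "\<lambda>_. topspace X"] exI[of _ 1])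
      (auto simp: step_const HM_ball_def HM_iff)
next
  case (insert N \<F>)
  then obtain V e where V: "step V" "0 < e" "\<forall>t\<in>{0..<1}. openin X (V t) \<and> f t \<in> V t"
    "HM_ball X V e \<subseteq> HM X \<inter> \<Inter>\<F>" by auto
  from insert.prems obtain a b W r where N: "N = HM_N X a b W r" "0 \<le> a" "a < b" "b \<le> 1"
    "\<forall>t\<in>{a..<b}. f t = f a" "nbhd X (f a) W" "0 < r"
    unfolding HM_subbase_at_def by blast
  obtain U where U: "openin X U" "f a \<in> U" "U \<subseteq> W" using N(6) by (auto simp: nbhd_def)
  define V' where "V' t = (if t \<in> {a..<b} then V t \<inter> U else V t)" for t
  have V': "step V'"
    unfolding V'_def using step_map2[OF step_ivl V(1), of "\<lambda>p A. if p then A \<inter> U else A"] by simp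
  have mono: "measure lebesgue A \<le> measure lebesgue {t \<in> {0..<1}. g t \<notin> V' t}"
    if "g \<in> HM X" "A \<in> lmeasurable" "A \<subseteq> {t \<in> {0..<1}. g t \<notin> V' t}" for g A
    using that V' by (intro measure_mono_fmeasurable fmeasurableD exceptional_lmeasurable)
      (auto simp: HM_iff)
  \<comment> \<open>The exceptional set for \<open>V'\<close> contains both the one for
    \<open>V\<close> and, since \<open>U\<close> is inside \<open>W\<close>, the part of
    \<open>{a..<b}\<close> where \<open>g\<close> misses \<open>W\<close>.\<close>
  have "HM_ball X V' (min e r) \<subseteq> HM_ball X V e \<inter> N"
  proof
    fix g assume "g \<in> HM_ball X V' (min e r)"
    then have g: "g \<in> HM X" "measure lebesgue {t \<in> {0..<1}. g t \<notin> V' t} < e"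
      "measure lebesgue {t \<in> {0..<1}. g t \<notin> V' t} < r" "step g"
      by (auto simp: HM_ball_def HM_iff)
    have "measure lebesgue {t \<in> {0..<1}. g t \<notin> V t} < e"
      by (rule le_less_trans[OF mono[OF g(1) exceptional_lmeasurable[OF g(4) V(1)]] g(2)])
        (auto simp: V'_def)
    moreover have "measure lebesgue {t \<in> {a..<b}. g t \<notin> W} < r"
      by (rule le_less_trans[OF mono[OF g(1) exceptional_ivl_lmeasurable[OF g(4) N(2,4)]] g(3)])
        (use N(1-4) U in \<open>auto simp: V'_def\<close>)
    ultimately show "g \<in> HM_ball X V e \<inter> N" using g(1) N(1) by (simp add: HM_ball_def HM_N_def)
  qed
  moreover have "openin X (V' t) \<and> f t \<in> V' t" if "t \<in> {0..<1}" for t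
  proof (cases "t \<in> {a..<b}")
    case True
    with N(5) have "f t = f a" by blast
    with U(2) have "f t \<in> U" by simp
    moreover have "openin X (V t)" "f t \<in> V t" using V(3) that by auto
    ultimately show ?thesis using True U(1) by (simp add: V'_def openin_Int)
  qed (use that V(3) in \<open>auto simp: V'_def\<close>)
  ultimately show ?case
    using V(2,4) N(7) V' by (intro exI[of _ V'] exI[of _ "min e r"] conjI) auto
qed

text \<open>The base property at \<open>f\<close>, in the elimination form in which the proofs of
  continuity and dicontinuity use it.\<close>

lemma openin_HM_imp_HM_ball:
  assumes "openin (HM_topology X) U" "f \<in> U"
  obtains V e where "step V" "0 < e" "\<And>t. t \<in> {0..<1} \<Longrightarrow> openin X (V t)"
    "\<And>t. t \<in> {0..<1} \<Longrightarrow> f t \<in> V t" "HM_ball X V e \<subseteq> U"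
proof -
  from assms obtain \<F> where "f \<in> HM X" "finite \<F>" "\<F> \<subseteq> HM_subbase_at X f" "HM X \<inter> \<Inter>\<F> \<subseteq> U"
    unfolding openin_HM_topology by blast
  with HM_ball_subset_Inter[of f X \<F>] show ?thesis using that by (meson order_trans)
qed

section \<open>The operations on the extension\<close>

lemma HM_apply: "f \<in> HM X \<Longrightarrow> t \<in> {0..<1} \<Longrightarrow> f t \<in> topspace X"
  by (auto simp: HM_iff)

lemma HM_mult_in_HM:
  assumes "\<And>x y. x \<in> topspace X \<Longrightarrow> y \<in> topspace X \<Longrightarrow> m x y \<in> topspace X"
    and "f \<in> HM X" "g \<in> HM X"
  shows "HM_mult m f g \<in> HM X"
  using assms step_map2[of f g m] HM_apply[of _ X]
  by (auto simp: HM_iff HM_mult_def step_restrict)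

lemma HM_unit_in_HM:
  assumes "\<And>x. x \<in> topspace X \<Longrightarrow> l x \<in> topspace X" and "f \<in> HM X"
  shows "HM_unit l f \<in> HM X"
  using assms step_map[of f l] HM_apply[of _ X]
  by (auto simp: HM_iff HM_unit_def step_restrict)

text \<open>Where the product misses \<open>V\<close>, the first factor misses \<open>P\<close> or
  the second misses \<open>Q\<close>; each happens on a set of measure less than
  \<open>e/2\<close>.\<close>

lemma HM_mult_in_HM_ball:
  assumes VPQ: "step V" "step P" "step Q"
    and sub: "\<And>t x y. t \<in> {0..<1} \<Longrightarrow> x \<in> topspace X \<inter> P t \<Longrightarrow> y \<in> topspace X \<inter> Q t \<Longrightarrow> m x y \<in> V t"
    and clo: "\<And>x y. x \<in> topspace X \<Longrightarrow> y \<in> topspace X \<Longrightarrow> m x y \<in> topspace X"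
    and f: "f \<in> HM_ball X P (e/2)" and g: "g \<in> HM_ball X Q (e/2)"
  shows "HM_mult m f g \<in> HM_ball X V e"
proof -
  have H: "f \<in> HM X" "g \<in> HM X" "step f" "step g" using f g by (auto simp: HM_ball_def HM_iff)
  then have M: "HM_mult m f g \<in> HM X" "step (HM_mult m f g)"
    using HM_mult_in_HM[of X m f g] clo by (auto simp: HM_iff)
  let ?A = "{t \<in> {0..<1}. f t \<notin> P t}" and ?B = "{t \<in> {0..<1}. g t \<notin> Q t}"
  have AB: "?A \<in> lmeasurable" "?B \<in> lmeasurable"
    using H VPQ by (simp_all only: exceptional_lmeasurable)
  have "{t \<in> {0..<1}. HM_mult m f g t \<notin> V t} \<subseteq> ?A \<union> ?B"
    using sub HM_apply[OF H(1)] HM_apply[OF H(2)] by (auto simp: HM_mult_def)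
  then have "measure lebesgue {t \<in> {0..<1}. HM_mult m f g t \<notin> V t} \<le> measure lebesgue (?A \<union> ?B)"
    by (intro measure_mono_fmeasurable fmeasurableD exceptional_lmeasurable M VPQ
        fmeasurable.Un AB)
  also have "\<dots> \<le> measure lebesgue ?A + measure lebesgue ?B"
    by (intro measure_Un_le fmeasurableD AB)
  also have "\<dots> < e" using f g by (simp add: HM_ball_def)
  finally show ?thesis using M by (simp add: HM_ball_def)
qed

text \<open>Continuity in \<open>X\<close> gives, for each \<open>t\<close>, neighbourhoods of
  \<open>f t\<close> and \<open>g t\<close> whose products lie in \<open>V t\<close>. They are
  assembled into step functions \<open>P\<close> and \<open>Q\<close>, whose balls of size
  \<open>e/2\<close> witness continuity at \<open>(f, g)\<close>.\<close>

lemma continuous_map_HM_mult: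
  assumes "continuous_map (prod_topology X X) X (\<lambda>(x, y). m x y)"
  shows "continuous_map (prod_topology (HM_topology X) (HM_topology X)) (HM_topology X)
    (\<lambda>(f, g). HM_mult m f g)"
proof -
  have clo: "m x y \<in> topspace X" if "x \<in> topspace X" "y \<in> topspace X" for x y
    using funcset_mem[OF continuous_map_funspace[OF assms], of "(x, y)"] that by simp
  have "\<exists>P Q. openin X P \<and> openin X Q \<and> x \<in> P \<and> y \<in> Q \<and> (\<forall>x\<in>P. \<forall>y\<in>Q. m x y \<in> V)"
    if "x \<in> topspace X" "y \<in> topspace X" "openin X V" "m x y \<in> V" for x y V
  proof -
    have "openin (prod_topology X X) {z \<in> topspace (prod_topology X X). (\<lambda>(x, y). m x y) z \<in> V}"
      by (rule openin_continuous_map_preimage[OF assms that(3)])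
    moreover have "(x, y) \<in> {z \<in> topspace (prod_topology X X). (\<lambda>(x, y). m x y) z \<in> V}"
      using that by simp
    ultimately obtain P Q where "openin X P" "openin X Q" "x \<in> P" "y \<in> Q"
      "P \<times> Q \<subseteq> {z \<in> topspace (prod_topology X X). (\<lambda>(x, y). m x y) z \<in> V}"
      unfolding openin_prod_topology_alt by meson
    then show ?thesis by (intro exI[of _ P] exI[of _ Q]) auto
  qed
  \<comment> \<open>The neighbourhoods are chosen as functions of the two points and the target set,
    not of \<open>t\<close>. Hence they change only where \<open>f\<close>, \<open>g\<close> or
    \<open>V\<close> does.\<close>
  then obtain p q where pq: "\<And>x y V. x \<in> topspace X \<Longrightarrow> y \<in> topspace X \<Longrightarrow> openin X V \<Longrightarrow> m x y \<in> V \<Longrightarrow>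
      openin X (p x y V) \<and> openin X (q x y V) \<and> x \<in> p x y V \<and> y \<in> q x y V \<and>
      (\<forall>x'\<in>p x y V. \<forall>y'\<in>q x y V. m x' y' \<in> V)"
    by metis
  show ?thesis
    unfolding continuous_map_def
  proof (intro conjI allI impI)
    show "(\<lambda>(f, g). HM_mult m f g) \<in>
        topspace (prod_topology (HM_topology X) (HM_topology X)) \<rightarrow> topspace (HM_topology X)"
      using HM_mult_in_HM[of X m] clo by (auto simp: topspace_HM_topology)
  next
    fix U assume U: "openin (HM_topology X) U"
    show "openin (prod_topology (HM_topology X) (HM_topology X))
        {z \<in> topspace (prod_topology (HM_topology X) (HM_topology X)). (\<lambda>(f, g). HM_mult m f g) z \<in> U}"
      unfolding openin_prod_topology_alt
    proof (intro allI impI)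
      fix f g
      assume "(f, g) \<in> {z \<in> topspace (prod_topology (HM_topology X) (HM_topology X)).
        (\<lambda>(f, g). HM_mult m f g) z \<in> U}"
      then have fg: "f \<in> HM X" "g \<in> HM X" "HM_mult m f g \<in> U"
        by (auto simp: topspace_HM_topology)
      obtain V e where V: "step V" "0 < e" "\<And>t. t \<in> {0..<1} \<Longrightarrow> openin X (V t)"
        "\<And>t. t \<in> {0..<1} \<Longrightarrow> HM_mult m f g t \<in> V t" "HM_ball X V e \<subseteq> U"
        using openin_HM_imp_HM_ball[OF U fg(3)] by metis
      define P where "P t = p (f t) (g t) (V t)" for t
      define Q where "Q t = q (f t) (g t) (V t)" for t
      have "step (\<lambda>t. (f t, g t, V t))"
        using fg V(1) by (intro step_Pair) (auto simp: HM_iff)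
      from step_map[OF this, of "\<lambda>(x, y, v). p x y v"] step_map[OF this, of "\<lambda>(x, y, v). q x y v"]
      have PQ: "step P" "step Q" by (simp_all add: P_def[abs_def] Q_def[abs_def])
      have pt: "openin X (P t) \<and> openin X (Q t) \<and> f t \<in> P t \<and> g t \<in> Q t \<and>
          (\<forall>x'\<in>P t. \<forall>y'\<in>Q t. m x' y' \<in> V t)" if "t \<in> {0..<1}" for t
        unfolding P_def Q_def using V(3,4)[OF that] that HM_apply fg(1,2)
        by (intro pq) (auto simp: HM_mult_def)
      show "\<exists>A B. openin (HM_topology X) A \<and> openin (HM_topology X) B \<and> f \<in> A \<and> g \<in> B \<and>
          A \<times> B \<subseteq> {z \<in> topspace (prod_topology (HM_topology X) (HM_topology X)).
            (\<lambda>(f, g). HM_mult m f g) z \<in> U}"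
      proof (intro exI conjI)
        show "openin (HM_topology X) (HM_ball X P (e/2))" "openin (HM_topology X) (HM_ball X Q (e/2))"
          using PQ pt by (auto intro!: openin_HM_ball)
        show "f \<in> HM_ball X P (e/2)" "g \<in> HM_ball X Q (e/2)"
          using fg V(2) pt by (auto intro!: HM_ballI)
        have "HM_mult m f' g' \<in> U" if "f' \<in> HM_ball X P (e/2)" "g' \<in> HM_ball X Q (e/2)" for f' g'
        proof -
          have "HM_mult m f' g' \<in> HM_ball X V e"
            by (rule HM_mult_in_HM_ball[where m = m, OF V(1) PQ _ clo that]) (use pt in auto)
          then show ?thesis using V(5) by blast
        qed
        then show "HM_ball X P (e/2) \<times> HM_ball X Q (e/2) \<subseteq>
            {z \<in> topspace (prod_topology (HM_topology X) (HM_topology X)).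
              (\<lambda>(f, g). HM_mult m f g) z \<in> U}"
          by (auto simp: topspace_HM_topology HM_ball_def)
      qed
    qed
  qed
qed

text \<open>With \<open>P t\<close> the preimage of \<open>V t\<close> under \<open>l\<close>, the
  exceptional set of \<open>HM_unit l g\<close> for \<open>V\<close> equals that of \<open>g\<close>
  for \<open>P\<close>, so the same \<open>e\<close> serves on both sides.\<close>

lemma continuous_map_HM_unit:
  assumes "continuous_map X X l"
  shows "continuous_map (HM_topology X) (HM_topology X) (HM_unit l)"
proof -
  have clo: "l x \<in> topspace X" if "x \<in> topspace X" for x
    using continuous_map_funspace[OF assms] that by auto
  show ?thesis
    unfolding continuous_map_def
  proof (intro conjI allI impI)
    show "HM_unit l \<in> topspace (HM_topology X) \<rightarrow> topspace (HM_topology X)"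
      using HM_unit_in_HM[of X l] clo by (auto simp: topspace_HM_topology)
  next
    fix U assume U: "openin (HM_topology X) U"
    show "openin (HM_topology X) {f \<in> topspace (HM_topology X). HM_unit l f \<in> U}"
    proof (subst openin_subopen, intro ballI)
      fix f assume "f \<in> {f \<in> topspace (HM_topology X). HM_unit l f \<in> U}"
      then have f: "f \<in> HM X" "HM_unit l f \<in> U" by (auto simp: topspace_HM_topology)
      obtain V e where V: "step V" "0 < e" "\<And>t. t \<in> {0..<1} \<Longrightarrow> openin X (V t)"
        "\<And>t. t \<in> {0..<1} \<Longrightarrow> HM_unit l f t \<in> V t" "HM_ball X V e \<subseteq> U"
        using openin_HM_imp_HM_ball[OF U f(2)] by metis
      define P where "P t = {x \<in> topspace X. l x \<in> V t}" for t
      have P: "step P" unfolding P_def by (rule step_map[OF V(1)])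
      have "openin X (P t)" "f t \<in> P t" if "t \<in> {0..<1}" for t
        using openin_continuous_map_preimage[OF assms V(3)[OF that]] V(4)[OF that] that
          HM_apply[OF f(1) that] by (auto simp: P_def HM_unit_def)
      then have "openin (HM_topology X) (HM_ball X P e)" "f \<in> HM_ball X P e"
        using P f V(2) by (auto intro!: openin_HM_ball HM_ballI)
      moreover have "HM_ball X P e \<subseteq> {f \<in> topspace (HM_topology X). HM_unit l f \<in> U}"
      proof
        fix g assume g: "g \<in> HM_ball X P e"
        then have g': "g \<in> HM X" by (simp add: HM_ball_def)
        have "{t \<in> {0..<1}. HM_unit l g t \<notin> V t} = {t \<in> {0..<1}. g t \<notin> P t}"
          using HM_apply[OF g'] by (auto simp: P_def HM_unit_def)
        then have "HM_unit l g \<in> HM_ball X V e"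
          using g HM_unit_in_HM[of X l g] clo by (simp add: HM_ball_def)
        with V(5) g' show "g \<in> {f \<in> topspace (HM_topology X). HM_unit l f \<in> U}"
          by (auto simp: topspace_HM_topology)
      qed
      ultimately show "\<exists>T. openin (HM_topology X) T \<and> f \<in> T \<and>
          T \<subseteq> {f \<in> topspace (HM_topology X). HM_unit l f \<in> U}" by blast
    qed
  qed
qed

section \<open>Dicontinuity of the extended unit operation\<close>

lemma dicontinuous_open:
  assumes "dicontinuous X m l" "openin X V" "x \<in> V"
  obtains U W where "openin X U" "openin X W" "x \<in> U" "l x \<in> W"
    "\<And>y a. y \<in> topspace X \<Longrightarrow> l y \<in> W \<Longrightarrow> a \<in> W \<Longrightarrow> a \<in> l ` topspace X \<Longrightarrow> m a y \<in> U \<Longrightarrow> y \<in> V"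
proof -
  have x: "x \<in> topspace X" using assms(2,3) openin_subset by blast
  have "nbhd X x V" using assms(2,3) openin_subset by (auto simp: nbhd_def)
  then obtain U W where UW: "nbhd X x U" "nbhd (subtopology X (l ` topspace X)) (l x) W"
    "left_quot X m W U \<inter> {y \<in> topspace X. l y \<in> W} \<subseteq> V"
    using assms(1) x unfolding dicontinuous_def by meson
  obtain U' where U': "openin X U'" "x \<in> U'" "U' \<subseteq> U" using UW(1) by (auto simp: nbhd_def)
  obtain W' where W': "openin X W'" "l x \<in> W'" "W' \<inter> l ` topspace X \<subseteq> W"
    using UW(2) by (auto simp: nbhd_def openin_subtopology)
  show ?thesis
  proof (rule that[OF U'(1) W'(1) U'(2) W'(2)])
    fix y a
    assume y: "y \<in> topspace X" "l y \<in> W'" "a \<in> W'" "a \<in> l ` topspace X" "m a y \<in> U'"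
    then have "l y \<in> W" "a \<in> W" "m a y \<in> U" using W'(3) U'(3) by auto
    with y(1) UW(3) show "y \<in> V" by (auto simp: left_quot_def)
  qed
qed

text \<open>Dicontinuity at \<open>f t\<close> forces \<open>y t\<close> into \<open>V t\<close>
  unless \<open>l (y t)\<close> or \<open>a t\<close> misses \<open>Q t\<close> or the product
  \<open>m (a t) (y t)\<close> misses \<open>P t\<close>. These three exceptional sets have measure
  less than \<open>e/3\<close> each.\<close>

lemma dicontinuous_HM_unit:
  assumes dic: "dicontinuous X m l"
    and clo: "\<And>x y. x \<in> topspace X \<Longrightarrow> y \<in> topspace X \<Longrightarrow> m x y \<in> topspace X"
  shows "dicontinuous (HM_topology X) (HM_mult m) (HM_unit l)"
  unfolding dicontinuous_def topspace_HM_topology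
proof (intro conjI ballI allI impI)
  have cont: "continuous_map X X l" using dic by (simp add: dicontinuous_def)
  then show "continuous_map (HM_topology X) (HM_topology X) (HM_unit l)"
    by (rule continuous_map_HM_unit)
  have lclo: "l x \<in> topspace X" if "x \<in> topspace X" for x
    using continuous_map_funspace[OF cont] that by auto
  define good where "good x V U W \<longleftrightarrow> openin X U \<and> openin X W \<and> x \<in> U \<and> l x \<in> W \<and>
    (\<forall>y\<in>topspace X. \<forall>a\<in>l ` topspace X. l y \<in> W \<longrightarrow> a \<in> W \<longrightarrow> m a y \<in> U \<longrightarrow> y \<in> V)" for x V U W
  \<comment> \<open>\<open>U\<close> is selected first and \<open>W\<close> relative to it, so that
    the two fit together. Both depend only on \<open>x\<close> and \<open>V\<close>, which makes
    \<open>P\<close> and \<open>Q\<close> below step functions.\<close>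
  define u where "u x V = (SOME U. \<exists>W. good x V U W)" for x V
  define w where "w x V = (SOME W. good x V (u x V) W)" for x V
  have uw: "good x V (u x V) (w x V)" if V: "openin X V" "x \<in> V" for x V
  proof -
    obtain U W where "openin X U" "openin X W" "x \<in> U" "l x \<in> W"
      "\<And>y a. y \<in> topspace X \<Longrightarrow> l y \<in> W \<Longrightarrow> a \<in> W \<Longrightarrow> a \<in> l ` topspace X \<Longrightarrow> m a y \<in> U \<Longrightarrow> y \<in> V"
      using dicontinuous_open[OF dic V] by blast
    then have "\<exists>U W. good x V U W" unfolding good_def by blast
    then have "\<exists>W. good x V (u x V) W" unfolding u_def by (rule someI_ex)
    then show ?thesis unfolding w_def by (rule someI_ex)
  qed
  fix f Of assume f: "f \<in> HM X" and "nbhd (HM_topology X) f Of"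
  then obtain G where G: "openin (HM_topology X) G" "f \<in> G" "G \<subseteq> Of"
    by (auto simp: nbhd_def)
  obtain V e where V: "step V" "0 < e" "\<And>t. t \<in> {0..<1} \<Longrightarrow> openin X (V t)"
    "\<And>t. t \<in> {0..<1} \<Longrightarrow> f t \<in> V t" "HM_ball X V e \<subseteq> G"
    using openin_HM_imp_HM_ball[OF G(1,2)] by metis
  define P where "P t = u (f t) (V t)" for t
  define Q where "Q t = w (f t) (V t)" for t
  have PQ: "step P" "step Q"
    unfolding P_def Q_def using f V(1) by (auto simp: HM_iff intro: step_map2)
  have pt: "openin X (P t) \<and> openin X (Q t) \<and> f t \<in> P t \<and> l (f t) \<in> Q t \<and>
      (\<forall>y\<in>topspace X. \<forall>a\<in>l ` topspace X. l y \<in> Q t \<longrightarrow> a \<in> Q t \<longrightarrow> m a y \<in> P t \<longrightarrow> y \<in> V t)"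
    if "t \<in> {0..<1}" for t
    unfolding P_def Q_def using uw[OF V(3,4)[OF that]] unfolding good_def .
  let ?U = "HM_ball X P (e/3)" and ?W = "HM_ball X Q (e/3) \<inter> HM_unit l ` HM X"
  have oU: "openin (HM_topology X) ?U" and oW: "openin (HM_topology X) (HM_ball X Q (e/3))"
    using PQ pt by (auto intro!: openin_HM_ball)
  have fU: "f \<in> ?U" using f V(2) pt by (auto intro!: HM_ballI)
  have fW: "HM_unit l f \<in> HM_ball X Q (e/3)"
    using HM_unit_in_HM[of X l f] lclo f V(2) pt by (auto intro!: HM_ballI simp: HM_unit_def)
  have "y \<in> HM_ball X V e"
    if y: "y \<in> HM X" and ly: "HM_unit l y \<in> HM_ball X Q (e/3)" and a: "a \<in> ?W"
      and ay: "HM_mult m a y \<in> ?U" for y a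
  proof -
    obtain b where b: "b \<in> HM X" "a = HM_unit l b" using a by auto
    let ?A = "{t \<in> {0..<1}. HM_unit l y t \<notin> Q t}" and ?B = "{t \<in> {0..<1}. a t \<notin> Q t}"
      and ?C = "{t \<in> {0..<1}. HM_mult m a y t \<notin> P t}"
    have step_y: "step y" "step a" "step (HM_unit l y)" "step (HM_mult m a y)"
      using y a ly ay by (auto simp: HM_iff HM_ball_def)
    have ABC: "?A \<in> lmeasurable" "?B \<in> lmeasurable" "?C \<in> lmeasurable"
      and y': "{t \<in> {0..<1}. y t \<notin> V t} \<in> lmeasurable"
      using PQ V(1) step_y by (simp_all only: exceptional_lmeasurable)
    have "{t \<in> {0..<1}. y t \<notin> V t} \<subseteq> ?A \<union> ?B \<union> ?C"
    proof
      fix t assume t: "t \<in> {t \<in> {0..<1}. y t \<notin> V t}"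
      then have "y t \<in> topspace X" "a t \<in> l ` topspace X"
        using HM_apply[OF y] HM_apply[OF b(1)] by (auto simp: b(2) HM_unit_def)
      with pt[of t] t have "\<not> (l (y t) \<in> Q t \<and> a t \<in> Q t \<and> m (a t) (y t) \<in> P t)" by auto
      with t show "t \<in> ?A \<union> ?B \<union> ?C" by (auto simp: HM_unit_def HM_mult_def)
    qed
    then have "measure lebesgue {t \<in> {0..<1}. y t \<notin> V t} \<le> measure lebesgue (?A \<union> ?B \<union> ?C)"
      by (intro measure_mono_fmeasurable fmeasurableD y' fmeasurable.Un ABC)
    also have "\<dots> \<le> measure lebesgue (?A \<union> ?B) + measure lebesgue ?C"
      by (intro measure_Un_le fmeasurableD fmeasurable.Un ABC)
    also have "measure lebesgue (?A \<union> ?B) \<le> measure lebesgue ?A + measure lebesgue ?B"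
      by (intro measure_Un_le fmeasurableD ABC)
    also have "measure lebesgue ?A + measure lebesgue ?B + measure lebesgue ?C < e"
      using ly a ay by (simp add: HM_ball_def)
    finally show ?thesis using y by (simp add: HM_ball_def)
  qed
  then have "left_quot (HM_topology X) (HM_mult m) ?W ?U \<inter> {y \<in> HM X. HM_unit l y \<in> ?W} \<subseteq> Of"
    using V(5) G(3) by (auto simp: left_quot_def)
  moreover have "nbhd (HM_topology X) f ?U"
    using oU fU openin_subset unfolding nbhd_def by blast
  moreover have "nbhd (subtopology (HM_topology X) (HM_unit l ` HM X)) (HM_unit l f) ?W"
    using oW fW f openin_subset[OF oW] unfolding nbhd_def openin_subtopology topspace_subtopology
    by blast
  ultimately show "\<exists>U W. nbhd (HM_topology X) f U \<and>
      nbhd (subtopology (HM_topology X) (HM_unit l ` HM X)) (HM_unit l f) W \<and>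
      left_quot (HM_topology X) (HM_mult m) W U \<inter> {y \<in> HM X. HM_unit l y \<in> W} \<subseteq> Of"
    by blast
qed

section \<open>The extension is a ditopological left unosemigroup\<close>

theorem theorem9:
  fixes X :: "'a topology"
    and m :: "'a \<Rightarrow> 'a \<Rightarrow> 'a"
    and l :: "'a \<Rightarrow> 'a"
  assumes "ditopological_left_unosemigroup X m l"
  shows "ditopological_left_unosemigroup (HM_topology X) (HM_mult m) (HM_unit l)"
proof -
  have ne: "topspace X \<noteq> {}"
    and cont: "continuous_map (prod_topology X X) X (\<lambda>(x, y). m x y)"
    and assoc: "\<And>x y z. x \<in> topspace X \<Longrightarrow> y \<in> topspace X \<Longrightarrow> z \<in> topspace X \<Longrightarrow>
      m (m x y) z = m x (m y z)"
    and unit: "\<And>x. x \<in> topspace X \<Longrightarrow> m (l x) x = x"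
    and lclo: "\<And>x. x \<in> topspace X \<Longrightarrow> l x \<in> topspace X"
    and dic: "dicontinuous X m l"
    using assms by (auto simp: ditopological_left_unosemigroup_def topological_semigroup_def
        left_unit_operation_def)
  have clo: "m x y \<in> topspace X" if "x \<in> topspace X" "y \<in> topspace X" for x y
    using funcset_mem[OF continuous_map_funspace[OF cont], of "(x, y)"] that by simp
  \<comment> \<open>Constant functions show that \<open>HM X\<close> is non-empty.\<close>
  obtain x where "x \<in> topspace X" using ne by blast
  then have "(\<lambda>t\<in>{0..<1}. x) \<in> HM X" by (simp add: HM_iff step_restrict step_const)
  moreover have "HM_mult m (HM_mult m f g) h = HM_mult m f (HM_mult m g h)"
    if "f \<in> HM X" "g \<in> HM X" "h \<in> HM X" for f g h
    using that HM_apply assoc by (fastforce simp: HM_mult_def restrict_def)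
  ultimately have "topological_semigroup (HM_topology X) (HM_mult m)"
    using continuous_map_HM_mult[OF cont]
    by (auto simp: topological_semigroup_def topspace_HM_topology)
  moreover have "HM_mult m (HM_unit l f) f = f" if f: "f \<in> HM X" for f
  proof
    fix t
    \<comment> \<open>For \<open>t\<close> in \<open>{0..<1}\<close> this is the unit law of
      \<open>X\<close> at \<open>f t\<close>; elsewhere both sides are
      \<open>undefined\<close>.\<close>
    show "HM_mult m (HM_unit l f) f t = f t"
      using f HM_apply[OF f, of t] unit PiE_arb[of f "{0..<1}" "\<lambda>_. topspace X" t]
      by (cases "t \<in> {0..<1}") (auto simp: HM_mult_def HM_unit_def HM_iff)
  qed
  then have "left_unit_operation (HM_topology X) (HM_mult m) (HM_unit l)"
    using HM_unit_in_HM[of X l] lclo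
    by (auto simp: left_unit_operation_def topspace_HM_topology)
  ultimately show ?thesis
    using dicontinuous_HM_unit[OF dic clo] by (simp add: ditopological_left_unosemigroup_def)
qed

end
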